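(* Let $E$ be an elliptic curve over a finite field $\mathbb{F}_q$ with equation $y^2+a_1xy+a_3y=x^3$, where $a_1,a_3\in\mathbb{F}_q$. (1) If $a_3$ is a cube in $\mathbb{F}_q$, then $E$ is isomorphic over $\mathbb{F}_q$ to a curve of the form $y^2+axy+y=x^3$ with $a\in\mathbb{F}_q$. (2) If $a_3$ is not a cube in $\mathbb{F}_q$ and $b_0\in\mathbb{F}_q$ is a fixed non-cube, then $E$ is isomorphic over $\mathbb{F}_q$ to a curve of the form $y^2+axy+b_0y=x^3$ or $y^2+axy+b_0^2y=x^3$ with $a\in\mathbb{F}_q$. Moreover, if $q\equiv -1 \pmod 3$, every elliptic curve over $\mathbb{F}_q$ with an $\mathbb{F}_q$-rational point of order $3$ admits, up to isomorphism over $\mathbb{F}_q$, an equation of the form $y^2+axy+y=x^3$ with $a\in\mathbb{F}_q$. *)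

theory Defs
  imports
    "HOL-Algebra.Algebraic_Closure_Type"
    "HOL-Computational_Algebra.Nth_Powers"
    "HOL-Number_Theory.Cong"
    "HOL-Library.Cardinality"
begin

text \<open>
  \<open>Weierstrass a1 a2 a3 a4 a6\<close> stands for the projective plane cubic with affine equation
  \<open>y^2 + a1 x y + a3 y = x^3 + a2 x^2 + a4 x + a6\<close>. Base change along a field embedding \<open>f\<close>
  is \<open>map_weierstrass f\<close>.
\<close>

datatype 'a weierstrass = Weierstrass (a1: 'a) (a2: 'a) (a3: 'a) (a4: 'a) (a6: 'a)

text \<open>The homogenised equation (left-hand side minus right-hand side) and its gradient.\<close>

definition cubic :: "'k::field weierstrass \<Rightarrow> 'k \<times> 'k \<times> 'k \<Rightarrow> 'k" where
  "cubic W = (\<lambda>(x, y, z).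
     y^2 * z + a1 W * x * y * z + a3 W * y * z^2
     - (x^3 + a2 W * x^2 * z + a4 W * x * z^2 + a6 W * z^3))"

definition cubic_gradient :: "'k::field weierstrass \<Rightarrow> 'k \<times> 'k \<times> 'k \<Rightarrow> 'k \<times> 'k \<times> 'k" where
  "cubic_gradient W = (\<lambda>(x, y, z).
     (a1 W * y * z - (3 * x^2 + 2 * a2 W * x * z + a4 W * z^2),
      2 * y * z + a1 W * x * z + a3 W * z^2,
      y^2 + a1 W * x * y + 2 * a3 W * y * z
        - (a2 W * x^2 + 2 * a4 W * x * z + 3 * a6 W * z^2)))"

lemma cubic_Taylor:
  fixes x y z u v w t :: "'k::field"
  shows "\<exists>r. cubic W (x + t * u, y + t * v, z + t * w) =
    cubic W (x, y, z)
    + t * (case cubic_gradient W (x, y, z) of (fx, fy, fz) \<Rightarrow> fx * u + fy * v + fz * w)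
    + t^2 * r"
proof (intro exI)
  show "cubic W (x + t * u, y + t * v, z + t * w) =
    cubic W (x, y, z)
    + t * (case cubic_gradient W (x, y, z) of (fx, fy, fz) \<Rightarrow> fx * u + fy * v + fz * w)
    + t^2 * (z * v^2 + 2 * y * v * w + t * v^2 * w
        + a1 W * (u * v * z + u * y * w + x * v * w + t * u * v * w)
        + a3 W * (y * w^2 + 2 * z * v * w + t * v * w^2)
        - (3 * x * u^2 + t * u^3
        + a2 W * (z * u^2 + 2 * x * u * w + t * u^2 * w)
        + a4 W * (x * w^2 + 2 * z * u * w + t * u * w^2)
        + a6 W * (3 * z * w^2 + t * w^3)))"
    by (simp add: cubic_def cubic_gradient_def algebra_simps power2_eq_square power3_eq_cube)
qed

text \<open>Smoothness is tested at all points over the algebraic closure.\<close>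

definition elliptic_curve :: "'a::field weierstrass \<Rightarrow> bool" where
  "elliptic_curve W \<longleftrightarrow>
     (\<forall>v. v \<noteq> (0, 0, 0) \<and> cubic (map_weierstrass to_ac W) v = 0 \<longrightarrow>
          cubic_gradient (map_weierstrass to_ac W) v \<noteq> (0, 0, 0))"

text \<open>A point of the projective plane is a line through the origin with the origin removed.\<close>

definition proj_point :: "'k::field \<times> 'k \<times> 'k \<Rightarrow> ('k \<times> 'k \<times> 'k) set" where
  "proj_point = (\<lambda>(x, y, z). {(c * x, c * y, c * z) | c. c \<noteq> 0})"

definition geometric_points ::
    "'a::field weierstrass \<Rightarrow> ('a alg_closure \<times> 'a alg_closure \<times> 'a alg_closure) set set" where
  "geometric_points W =
     {proj_point v | v. v \<noteq> (0, 0, 0) \<and> cubic (map_weierstrass to_ac W) v = 0}"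

definition base_point :: "('k::field \<times> 'k \<times> 'k) set" where
  "base_point = proj_point (0, 1, 0)"

text \<open>
  The homogeneous polynomial of degree \<open>d\<close> whose coefficient at
  \<open>x^i y^j z^(d-i-j)\<close> is \<open>c i j\<close>, an element of the ground field, evaluated over the
  algebraic closure.
\<close>

definition form_eval ::
    "nat \<Rightarrow> (nat \<Rightarrow> nat \<Rightarrow> 'a::field) \<Rightarrow>
     'a alg_closure \<times> 'a alg_closure \<times> 'a alg_closure \<Rightarrow> 'a alg_closure" where
  "form_eval d c = (\<lambda>(x, y, z).
     \<Sum>i\<le>d. \<Sum>j\<le>d - i. to_ac (c i j) * x^i * y^j * z^(d - i - j))"

text \<open>
  A morphism defined over the ground field: near every geometric point it is given by a triple of
  forms of equal degree with coefficients in the ground field, not all vanishing at that point.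
\<close>

definition morphism_over ::
    "'a::field weierstrass \<Rightarrow> 'a weierstrass \<Rightarrow>
     (('a alg_closure \<times> 'a alg_closure \<times> 'a alg_closure) set \<Rightarrow>
      ('a alg_closure \<times> 'a alg_closure \<times> 'a alg_closure) set) \<Rightarrow> bool" where
  "morphism_over W W' \<phi> \<longleftrightarrow>
     (\<forall>P \<in> geometric_points W. \<phi> P \<in> geometric_points W' \<and>
        (\<exists>d f g h. let F = (\<lambda>v. (form_eval d f v, form_eval d g v, form_eval d h v)) in
           (\<exists>v\<in>P. F v \<noteq> (0, 0, 0)) \<and>
           (\<forall>v. proj_point v \<in> geometric_points W \<and> F v \<noteq> (0, 0, 0) \<longrightarrow>
                \<phi> (proj_point v) = proj_point (F v))))"

definition isomorphic_over :: "'a::field weierstrass \<Rightarrow> 'a weierstrass \<Rightarrow> bool" where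
  "isomorphic_over W W' \<longleftrightarrow>
     (\<exists>\<phi> \<psi>. morphism_over W W' \<phi> \<and> morphism_over W' W \<psi> \<and>
        (\<forall>P \<in> geometric_points W. \<psi> (\<phi> P) = P) \<and>
        (\<forall>Q \<in> geometric_points W'. \<phi> (\<psi> Q) = Q) \<and>
        \<phi> base_point = base_point)"

text \<open>
  Rational points in affine coordinates; \<open>Infinity\<close> is the point \<open>[0 : 1 : 0]\<close>, the only one on
  the line \<open>z = 0\<close>, and the neutral element of the chord-tangent group law.
\<close>

datatype 'a point = Infinity | Affine 'a 'a

definition rational_points :: "'a::field weierstrass \<Rightarrow> 'a point set" where
  "rational_points W = insert Infinity
     {Affine x y | x y.
        y^2 + a1 W * x * y + a3 W * y = x^3 + a2 W * x^2 + a4 W * x + a6 W}"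

fun point_add :: "'a::field weierstrass \<Rightarrow> 'a point \<Rightarrow> 'a point \<Rightarrow> 'a point" where
  "point_add W Infinity Q = Q"
| "point_add W P Infinity = P"
| "point_add W (Affine x1 y1) (Affine x2 y2) =
     (if x1 = x2 \<and> y1 + y2 + a1 W * x2 + a3 W = 0 then Infinity
      else let
        l = (if x1 = x2
             then (3 * x1^2 + 2 * a2 W * x1 + a4 W - a1 W * y1) / (2 * y1 + a1 W * x1 + a3 W)
             else (y2 - y1) / (x2 - x1));
        m = y1 - l * x1;
        x3 = l^2 + a1 W * l - a2 W - x1 - x2;
        y3 = - (l + a1 W) * x3 - m - a3 W
      in Affine x3 y3)"

definition point_multiple :: "'a::field weierstrass \<Rightarrow> nat \<Rightarrow> 'a point \<Rightarrow> 'a point" where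
  "point_multiple W n P = (point_add W P ^^ n) Infinity"

definition has_order :: "'a::field weierstrass \<Rightarrow> 'a point \<Rightarrow> nat \<Rightarrow> bool" where
  "has_order W P n \<longleftrightarrow>
     0 < n \<and> point_multiple W n P = Infinity \<and>
     (\<forall>m. 0 < m \<and> m < n \<longrightarrow> point_multiple W m P \<noteq> Infinity)"

end

theory Submission
  imports Defs
begin

text \<open>
  A Weierstrass change of coordinates scaled by \<open>v\<close> multiplies \<open>a1\<close> by \<open>v\<close> and \<open>a3\<close> by
  \<open>v^3\<close>, so the shape \<open>y^2 + a1 x y + a3 y = x^3\<close> is governed by the class of \<open>a3\<close> modulo
  cubes; the nonzero cubes have index at most 3 in the multiplicative group, and index 1 if
  \<open>q \<equiv> -1 (mod 3)\<close>. If \<open>P\<close> has order 3, then \<open>P\<close> is a flex: moving \<open>P\<close> to the origin and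
  its tangent to the line \<open>y = 0\<close> kills \<open>a2\<close>, \<open>a4\<close> and \<open>a6\<close>.
\<close>

section \<open>Changes of coordinates\<close>

definition scale_curve :: "'k::field \<Rightarrow> 'k weierstrass \<Rightarrow> 'k weierstrass" where
  "scale_curve v W = Weierstrass (v * a1 W) (v^2 * a2 W) (v^3 * a3 W) (v^4 * a4 W) (v^6 * a6 W)"

text \<open>The classical coefficients after substituting \<open>x + r\<close> for \<open>x\<close>
  and \<open>y + s x + t\<close> for \<open>y\<close>.\<close>

definition shift_curve :: "'k::field \<Rightarrow> 'k \<Rightarrow> 'k \<Rightarrow> 'k weierstrass \<Rightarrow> 'k weierstrass" where
  "shift_curve r s t W = Weierstrass
     (a1 W + 2 * s)
     (a2 W - s * a1 W + 3 * r - s^2)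
     (a3 W + r * a1 W + 2 * t)
     (a4 W - s * a3 W + 2 * r * a2 W - (t + r * s) * a1 W + 3 * r^2 - 2 * s * t)
     (a6 W + r * a4 W + r^2 * a2 W + r^3 - t * a3 W - t^2 - r * t * a1 W)"

definition change_coordinates ::
    "'k::field \<Rightarrow> 'k \<Rightarrow> 'k \<Rightarrow> 'k \<Rightarrow> 'k weierstrass \<Rightarrow> 'k weierstrass" where
  "change_coordinates v r s t W = scale_curve v (shift_curve r s t W)"

text \<open>
  The new coordinates are \<open>x' = v^2 (x - r)\<close> and \<open>y' = v^3 (y - s (x - r) - t)\<close>, that is,
  \<open>v = 1/u\<close> in the usual substitution \<open>x = u^2 x' + r\<close>, \<open>y = u^3 y' + s u^2 x' + t\<close>; this
  direction avoids divisions.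
\<close>

definition new_coordinates :: "'k::field \<Rightarrow> 'k \<Rightarrow> 'k \<Rightarrow> 'k \<Rightarrow> 'k \<times> 'k \<times> 'k \<Rightarrow> 'k \<times> 'k \<times> 'k" where
  "new_coordinates v r s t = (\<lambda>(x, y, z).
     (v^2 * (x - r * z), v^3 * (y - s * (x - r * z) - t * z), z))"

lemma cubic_scale_curve:
  "cubic (scale_curve v W) (v^2 * x, v^3 * y, z) = v^6 * cubic W (x, y, z)"
  unfolding cubic_def scale_curve_def weierstrass.sel prod.case by Groebner_Basis.algebra

lemma cubic_shift_curve:
  "cubic (shift_curve r s t W) (x, y, z) = cubic W (x + r * z, y + s * x + t * z, z)"
  unfolding cubic_def shift_curve_def weierstrass.sel prod.case by Groebner_Basis.algebra

lemma cubic_change_coordinates: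
  "cubic (change_coordinates v r s t W) (new_coordinates v r s t p) = v^6 * cubic W p"
  by (cases p)
    (simp add: change_coordinates_def new_coordinates_def cubic_scale_curve cubic_shift_curve)

text \<open>Chain rule applied to \<open>cubic_scale_curve\<close>: the inner derivatives
  \<open>v^2\<close>, \<open>v^3\<close> and 1 are cancelled against \<open>v^6\<close>. The result
  is a polynomial identity, so \<open>v = 0\<close> is allowed.\<close>

lemma cubic_gradient_scale_curve:
  "cubic_gradient (scale_curve v W) (v^2 * x, v^3 * y, z) =
     (case cubic_gradient W (x, y, z) of (fx, fy, fz) \<Rightarrow> (v^4 * fx, v^3 * fy, v^6 * fz))"
  unfolding cubic_gradient_def scale_curve_def weierstrass.sel prod.case prod.inject
  by (intro conjI; Groebner_Basis.algebra)

text \<open>Chain rule again: the gradient is multiplied by the transpose of the linear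
  substitution.\<close>

lemma cubic_gradient_shift_curve:
  "cubic_gradient (shift_curve r s t W) (x, y, z) =
     (case cubic_gradient W (x + r * z, y + s * x + t * z, z) of
        (fx, fy, fz) \<Rightarrow> (fx + s * fy, fy, r * fx + t * fy + fz))"
  unfolding cubic_gradient_def shift_curve_def weierstrass.sel prod.case prod.inject
  by (intro conjI; Groebner_Basis.algebra)

lemma cubic_gradient_change_coordinates:
  assumes "cubic_gradient (change_coordinates v r s t W) (new_coordinates v r s t p) = (0, 0, 0)"
    and "v \<noteq> 0"
  shows "cubic_gradient W p = (0, 0, 0)"
proof -
  obtain x y z where p: "p = (x, y, z)" by (cases p)
  define x' where "x' = x - r * z"
  define y' where "y' = y - s * x' - t * z"
  have p': "p = (x' + r * z, y' + s * x' + t * z, z)" by (simp add: p x'_def y'_def)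
  obtain fx fy fz where f: "cubic_gradient W p = (fx, fy, fz)" by (metis prod_cases3)
  have "cubic_gradient (scale_curve v (shift_curve r s t W)) (v^2 * x', v^3 * y', z) = (0, 0, 0)"
    using assms(1) by (simp add: change_coordinates_def new_coordinates_def p x'_def y'_def)
  then show ?thesis
    unfolding cubic_gradient_scale_curve cubic_gradient_shift_curve p'[symmetric] f
    using assms(2) by auto
qed

lemma map_change_coordinates:
  "map_weierstrass to_ac (change_coordinates v r s t W) =
   change_coordinates (to_ac v) (to_ac r) (to_ac s) (to_ac t) (map_weierstrass to_ac W)"
  by (cases W) (simp add: change_coordinates_def scale_curve_def shift_curve_def)

text \<open>Solving for the old coordinates gives a map of the same shape, so the parameters of the
  inverse are polynomials in \<open>v\<close>, \<open>r\<close>, \<open>s\<close>, \<open>t\<close>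
  apart from \<open>1 / v\<close>.\<close>

lemma new_coordinates_inverse:
  assumes "v \<noteq> 0"
  shows "new_coordinates v r s t
           (new_coordinates (1 / v) (- (v^2 * r)) (- (v * s)) (v^3 * (s * r - t)) p) = p" (is ?right)
    and "new_coordinates (1 / v) (- (v^2 * r)) (- (v * s)) (v^3 * (s * r - t))
           (new_coordinates v r s t p) = p" (is ?left)
proof -
  obtain x y z where p: "p = (x, y, z)" by (cases p)
  define u where "u = 1 / v"
  have u: "u^2 * v^2 = 1" "u^3 * v^3 = 1" using assms by (simp_all add: u_def power_divide)
  show ?right
    unfolding p new_coordinates_def prod.case prod.inject u_def[symmetric]
    by (intro conjI refl; use u in Groebner_Basis.algebra)
  show ?left
    unfolding p new_coordinates_def prod.case prod.inject u_def[symmetric]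
    by (intro conjI refl; use u in Groebner_Basis.algebra)
qed

lemma new_coordinates_eq_0_iff:
  assumes "v \<noteq> 0"
  shows "new_coordinates v r s t p = (0, 0, 0) \<longleftrightarrow> p = (0, 0, 0)"
  using assms by (cases p) (auto simp: new_coordinates_def)

lemma elliptic_curve_change_coordinates:
  assumes "elliptic_curve W" "v \<noteq> 0"
  shows "elliptic_curve (change_coordinates v r s t W)"
  unfolding elliptic_curve_def map_change_coordinates
proof (intro allI impI notI)
  fix q :: "'a alg_closure \<times> 'a alg_closure \<times> 'a alg_closure"
  let ?W = "map_weierstrass to_ac W"
  let ?W' = "change_coordinates (to_ac v) (to_ac r) (to_ac s) (to_ac t) ?W"
  let ?T = "new_coordinates (to_ac v) (to_ac r) (to_ac s) (to_ac t)"
  assume q: "q \<noteq> (0, 0, 0) \<and> cubic ?W' q = 0" and grad: "cubic_gradient ?W' q = (0, 0, 0)"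
  have v: "to_ac v \<noteq> 0" using assms by simp
  \<comment> \<open>The coordinate map is onto, so a singular point of the new curve pulls back to
    one of \<open>W\<close>.\<close>
  obtain p where p: "q = ?T p" using new_coordinates_inverse(1)[OF v] by metis
  have "p \<noteq> (0, 0, 0)" using q v by (simp add: p new_coordinates_eq_0_iff)
  moreover have "cubic ?W p = 0"
    using q v by (simp add: p cubic_change_coordinates)
  ultimately have "cubic_gradient ?W p \<noteq> (0, 0, 0)"
    using assms(1) unfolding elliptic_curve_def by blast
  moreover have "cubic_gradient ?W p = (0, 0, 0)"
    using cubic_gradient_change_coordinates[OF grad[unfolded p] v] .
  ultimately show False by simp
qed

section \<open>Coordinate changes as isomorphisms of projective curves\<close>

lemma proj_point_new_coordinates:
  "new_coordinates v r s t ` proj_point p = proj_point (new_coordinates v r s t p)"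
proof -
  \<comment> \<open>As an image of the nonzero scalars, a projective point is carried along by any
    map that commutes with scaling.\<close>
  have range: "proj_point (x, y, z) = (\<lambda>c. (c * x, c * y, c * z)) ` (- {0})" for x y z :: 'a
    by (auto simp: proj_point_def)
  obtain x y z where p: "p = (x, y, z)" by (cases p)
  obtain x' y' z' where p': "new_coordinates v r s t (x, y, z) = (x', y', z')"
    by (metis prod_cases3)
  then have scale: "new_coordinates v r s t (c * x, c * y, c * z) = (c * x', c * y', c * z')" for c
    unfolding new_coordinates_def prod.case prod.inject
    by (elim conjE, hypsubst) (simp add: algebra_simps)
  show ?thesis
    unfolding p p' range image_image scale by (rule refl)
qed

lemma self_in_proj_point: "p \<in> proj_point p"
  by (cases p) (auto simp: proj_point_def intro: exI[of _ 1])

text \<open>\<open>form_eval 1\<close> reads the indices (1,0), (0,1) and (0,0); the last is the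
  coefficient of \<open>z\<close>.\<close>

definition linear_form :: "'a \<Rightarrow> 'a \<Rightarrow> 'a \<Rightarrow> nat \<Rightarrow> nat \<Rightarrow> 'a" where
  "linear_form a b c i j = (if i = 1 then a else if j = 1 then b else c)"

lemma form_eval_linear:
  "form_eval 1 (linear_form a b c) (x, y, z) = to_ac a * x + to_ac b * y + to_ac c * z"
  by (simp add: form_eval_def linear_form_def)

text \<open>The map is linear and invertible, so a single triple of forms of degree 1 describes it
  near every point.\<close>

lemma morphism_over_new_coordinates:
  fixes v r s t :: "'a::field"
  defines "T \<equiv> new_coordinates (to_ac v) (to_ac r) (to_ac s) (to_ac t)"
  assumes v: "v \<noteq> 0"
    and cubic: "\<And>p. cubic (map_weierstrass to_ac W) p = 0 \<Longrightarrow> cubic (map_weierstrass to_ac W') (T p) = 0"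
  shows "morphism_over W W' ((`) T)"
  unfolding morphism_over_def
proof (intro ballI conjI)
  fix P assume "P \<in> geometric_points W"
  then obtain p where p: "P = proj_point p" "p \<noteq> (0, 0, 0)" "cubic (map_weierstrass to_ac W) p = 0"
    by (auto simp: geometric_points_def)
  have Tp: "T p \<noteq> (0, 0, 0)"
    using v p(2) by (simp add: T_def new_coordinates_eq_0_iff)
  have image: "T ` proj_point w = proj_point (T w)" for w
    by (simp add: T_def proj_point_new_coordinates)
  show "T ` P \<in> geometric_points W'"
    using p(3) Tp cubic unfolding geometric_points_def p(1) image by blast
  let ?f = "linear_form (v^2) 0 (- (v^2 * r))"
    and ?g = "linear_form (- (v^3 * s)) (v^3) (v^3 * (s * r - t))"
    and ?h = "linear_form 0 0 (1::'a)"
  have F: "(form_eval 1 ?f w, form_eval 1 ?g w, form_eval 1 ?h w) = T w" for w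
    by (cases w) (simp add: form_eval_linear[unfolded One_nat_def] T_def new_coordinates_def
        algebra_simps)
  have T_image: "(\<exists>w\<in>P. T w \<noteq> (0, 0, 0)) \<and>
      (\<forall>w. proj_point w \<in> geometric_points W \<and> T w \<noteq> (0, 0, 0) \<longrightarrow>
        T ` proj_point w = proj_point (T w))"
    using self_in_proj_point[of p] Tp p(1) image by blast
  show "\<exists>d f g h. let F = (\<lambda>w. (form_eval d f w, form_eval d g w, form_eval d h w)) in
      (\<exists>w\<in>P. F w \<noteq> (0, 0, 0)) \<and>
      (\<forall>w. proj_point w \<in> geometric_points W \<and> F w \<noteq> (0, 0, 0) \<longrightarrow>
        T ` proj_point w = proj_point (F w))"
    unfolding Let_def
    by (rule exI[of _ 1], rule exI[of _ ?f], rule exI[of _ ?g], rule exI[of _ ?h])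
      (unfold F, rule T_image)
qed

lemma isomorphic_over_change_coordinates:
  assumes "v \<noteq> 0"
  shows "isomorphic_over W (change_coordinates v r s t W)"
proof -
  define T where "T = new_coordinates (to_ac v) (to_ac r) (to_ac s) (to_ac t)"
  define S where "S = new_coordinates (to_ac (1 / v)) (to_ac (- (v^2 * r))) (to_ac (- (v * s)))
    (to_ac (v^3 * (s * r - t)))"
  have v: "to_ac v \<noteq> 0" using assms by simp
  have TS: "T (S p) = p" and ST: "S (T p) = p" for p
    using new_coordinates_inverse[OF v, of "to_ac r" "to_ac s" "to_ac t" p]
    by (simp_all add: T_def S_def)
  have cubic: "cubic (map_weierstrass to_ac (change_coordinates v r s t W)) (T p) =
      to_ac v ^ 6 * cubic (map_weierstrass to_ac W) p" for p
    by (simp add: map_change_coordinates cubic_change_coordinates T_def)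
  have "morphism_over W (change_coordinates v r s t W) ((`) T)"
    unfolding T_def using assms cubic
    by (intro morphism_over_new_coordinates) (auto simp: T_def)
  \<comment> \<open>Since \<open>T (S q) = q\<close>, the transformation rule at \<open>S q\<close>
    reads \<open>0 = v^6 * cubic W (S q)\<close> over the closure.\<close>
  moreover have "cubic (map_weierstrass to_ac W) (S q) = 0"
    if "cubic (map_weierstrass to_ac (change_coordinates v r s t W)) q = 0" for q
    using cubic[of "S q"] that v by (simp add: TS)
  then have "morphism_over (change_coordinates v r s t W) W ((`) S)"
    unfolding S_def using assms
    by (intro morphism_over_new_coordinates) auto
  moreover have "T ` base_point = base_point"
  proof -
    have T010: "T (0, 1, 0) = (0, to_ac v ^ 3, 0)"
      by (simp add: T_def new_coordinates_def)
    have "\<exists>d. c = d * to_ac v ^ 3 \<and> d \<noteq> 0" if "c \<noteq> 0" for c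
      using that v by (intro exI[of _ "c / to_ac v ^ 3"]) simp
    then have "proj_point (0, to_ac v ^ 3, 0) = proj_point (0, 1, 0)"
      using v by (auto simp: proj_point_def)
    then show ?thesis
      unfolding base_point_def T_def proj_point_new_coordinates T010[unfolded T_def] .
  qed
  ultimately show ?thesis
    unfolding isomorphic_over_def
    by (intro exI[of _ "(`) T"] exI[of _ "(`) S"]) (simp add: image_image TS ST)
qed

section \<open>Rescaling the coefficient of y\<close>

lemma elliptic_curve_a3_nonzero:
  assumes "elliptic_curve (Weierstrass a 0 b 0 0)"
  shows "b \<noteq> 0"
proof
  assume "b = 0"
  \<comment> \<open>The affine origin lies on the curve, and the gradient there is
    \<open>(0, b, 0)\<close>.\<close>
  with assms[unfolded elliptic_curve_def, rule_format, of "(0, 0, 1)"] show False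
    by (simp add: cubic_def cubic_gradient_def)
qed

text \<open>Scaling by \<open>1 / c\<close> divides \<open>a3\<close> by \<open>c^3\<close>;
  smoothness forces \<open>b\<close>, and hence \<open>c\<close>, to be nonzero.\<close>

lemma rescale_a3:
  assumes "elliptic_curve (Weierstrass a 0 b 0 0)" "b = c^3 * b'"
  shows "\<exists>a'. elliptic_curve (Weierstrass a' 0 b' 0 0) \<and>
    isomorphic_over (Weierstrass a 0 b 0 0) (Weierstrass a' 0 b' 0 0)"
proof -
  have c: "c \<noteq> 0" using elliptic_curve_a3_nonzero[OF assms(1)] assms(2) by auto
  have "change_coordinates (1 / c) 0 0 0 (Weierstrass a 0 b 0 0) = Weierstrass (a / c) 0 b' 0 0"
    using c assms(2) by (simp add: change_coordinates_def scale_curve_def shift_curve_def field_simps)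
  with elliptic_curve_change_coordinates[OF assms(1), of "1 / c" 0 0 0]
    isomorphic_over_change_coordinates[of "1 / c" "Weierstrass a 0 b 0 0" 0 0 0] c
  show ?thesis by auto
qed

section \<open>Cubes in finite fields\<close>

lemma card_nth_roots_le:
  fixes y :: "'a::idom"
  assumes "0 < n"
  shows "card {x. x^n = y} \<le> n"
proof -
  let ?p = "monom 1 n - [:y:]"
  have "coeff ?p n = 1" using assms by (cases n) (simp_all add: coeff_pCons)
  then have ne: "?p \<noteq> 0" by (metis coeff_0 zero_neq_one)
  have eq: "{x. x^n = y} = {x. poly ?p x = 0}" by (simp add: poly_monom)
  have "degree ?p \<le> n" by (intro degree_diff_le) (simp_all add: degree_monom_le)
  then show ?thesis
    unfolding eq using card_poly_roots_bound[OF ne] by linarith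
qed

text \<open>Counting replaces the structure of the multiplicative group. Let \<open>C\<close> be the
  nonzero cubes. The sets \<open>C\<close>, \<open>b C\<close>, \<open>b^2 C\<close> are disjoint,
  so a further nonzero \<open>a\<close> outside them would give \<open>3 * card C < q - 1\<close>;
  but cubing has fibres of size at most 3, so \<open>q - 1 \<le> 3 * card C\<close>.\<close>

lemma cube_coset_cases:
  fixes a b :: "'a::{field,finite}"
  assumes a: "\<not> is_nth_power 3 a" and b: "\<not> is_nth_power 3 b"
  shows "\<exists>c. a = c^3 * b \<or> a = c^3 * b^2"
proof (rule ccontr)
  assume contra: "\<nexists>c. a = c^3 * b \<or> a = c^3 * b^2"
  define U where "U = - {0::'a}"
  define C where "C = (\<lambda>x. x^3) ` U"
  have zero: "is_nth_power 3 (0::'a)"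
    unfolding is_nth_power_def by (rule exI[of _ 0]) simp
  have b0: "b \<noteq> 0" and a0: "a \<noteq> 0" using a b zero by auto
  have noncube: "y^3 \<noteq> b * x^3" if "x \<noteq> 0" for x y
  proof
    assume "y^3 = b * x^3"
    then have "b = (y / x)^3" using that by (simp add: field_simps)
    with b show False unfolding is_nth_power_def by blast
  qed
  have disj1: "C \<inter> (*) b ` C = {}"
    using noncube by (auto simp: C_def U_def)
  have disj2: "C \<inter> (*) (b^2) ` C = {}"
  proof -
    have "x^3 \<noteq> b^2 * y^3" if "x \<noteq> 0" for x y
    proof
      assume "x^3 = b^2 * y^3"
      \<comment> \<open>Multiplying by \<open>b\<close> completes the cube \<open>b^3\<close> and
        makes \<open>b\<close> a quotient of cubes.\<close>
      then have "(b * y)^3 = b * x^3" by (simp add: power_mult_distrib power3_eq_cube power2_eq_square)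
      with noncube[OF that] show False by blast
    qed
    then show ?thesis by (auto simp: C_def U_def)
  qed
  \<comment> \<open>Multiplication by \<open>b\<close> is injective, so the third intersection is a
    translate of the first.\<close>
  have "(*) b ` C \<inter> (*) (b^2) ` C = (*) b ` (C \<inter> (*) b ` C)"
    using b0 by (simp add: image_Int inj_on_def image_image power2_eq_square mult.assoc)
  then have disj3: "(*) b ` C \<inter> (*) (b^2) ` C = {}" by (simp add: disj1)
  have card_coset: "card ((*) d ` C) = card C" if "d \<noteq> 0" for d
    using that by (intro card_image) (simp add: inj_on_def)
  have "insert a (C \<union> (*) b ` C \<union> (*) (b^2) ` C) \<subseteq> U"
    using a0 b0 by (auto simp: U_def C_def)
  then have "card (insert a (C \<union> (*) b ` C \<union> (*) (b^2) ` C)) \<le> card U"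
    by (intro card_mono) auto
  moreover have "a \<notin> C \<union> (*) b ` C \<union> (*) (b^2) ` C"
    using contra a by (auto simp: C_def is_nth_power_def mult.commute)
  moreover have "card (C \<union> (*) b ` C \<union> (*) (b^2) ` C) = 3 * card C"
    using b0 disj1 disj2 disj3
    by (simp add: card_Un_disjoint Int_Un_distrib2 card_coset)
  ultimately have lower: "3 * card C < card U" by simp
  have "U \<subseteq> (\<Union>y\<in>C. {x. x^3 = y})" by (auto simp: C_def)
  then have "card U \<le> card (\<Union>y\<in>C. {x. x^3 = y})" by (intro card_mono) auto
  also have "\<dots> \<le> (\<Sum>y\<in>C. card {x. x^3 = y})" by (intro card_UN_le) auto
  also have "\<dots> \<le> (\<Sum>y\<in>C. 3)" by (intro sum_mono card_nth_roots_le) simp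
  finally show False using lower by simp
qed

text \<open>Multiplication by \<open>x\<close> permutes the nonzero elements; compare their product
  before and after.\<close>

lemma finite_field_power_card_minus_1:
  fixes x :: "'a::{field,finite}"
  assumes "x \<noteq> 0"
  shows "x ^ (CARD('a) - 1) = 1"
proof -
  let ?U = "- {0::'a}"
  have "prod id ?U = (\<Prod>y\<in>?U. x * y)"
    using assms
    by (intro prod.reindex_bij_witness[of _ "\<lambda>y. x * y" "\<lambda>y. y / x"]) auto
  also have "\<dots> = x ^ card ?U * prod id ?U" by (simp add: prod.distrib)
  finally have "x ^ card ?U = 1" by simp
  then show ?thesis by (simp add: Compl_eq_Diff_UNIV)
qed

lemma all_cubes:
  fixes x :: "'a::{field,finite}"
  assumes "[int CARD('a) = -1] (mod 3)"
  shows "is_nth_power 3 x"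
proof (cases "x = 0")
  case True
  then show ?thesis unfolding is_nth_power_def by (intro exI[of _ 0]) simp
next
  case False
  have "int CARD('a) mod 3 = 2" using assms by (simp add: cong_def)
  then have "CARD('a) mod 3 = 2" by presburger
  then obtain m where m: "CARD('a) = 3 * m + 2" by (metis mult_div_mod_eq)
  \<comment> \<open>With \<open>q = 3m + 2\<close>, the exponent \<open>2m + 1\<close> inverts 3
    modulo \<open>q - 1\<close>: \<open>3(2m + 1) = 1 + 2(q - 1)\<close>.\<close>
  have "(x ^ (2 * m + 1))^3 = x * (x ^ (CARD('a) - 1))^2"
    unfolding m by (simp flip: power_mult power_Suc add: algebra_simps eval_nat_numeral)
  also have "\<dots> = x" using finite_field_power_card_minus_1[OF False] by simp
  finally show ?thesis unfolding is_nth_power_def by metis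
qed

section \<open>Points of order three\<close>

text \<open>Here \<open>l\<close> is the slope of the tangent at \<open>P\<close>. The denominator
  is nonzero because \<open>2P\<close> is not \<open>Infinity\<close>, and the last equation says
  that \<open>2P\<close> and \<open>P\<close> have the same \<open>x\<close>-coordinate, as
  \<open>2P = -P\<close> requires.\<close>

lemma order_three_point:
  assumes "has_order E P 3"
  obtains x y l where "P = Affine x y" "2 * y + a1 E * x + a3 E \<noteq> 0"
    "l * (2 * y + a1 E * x + a3 E) = 3 * x^2 + 2 * a2 E * x + a4 E - a1 E * y"
    "l^2 + a1 E * l = a2 E + 3 * x"
proof -
  have multiples: "point_add E P (point_add E P (point_add E P Infinity)) = Infinity"
    "point_add E P Infinity \<noteq> Infinity" "point_add E P (point_add E P Infinity) \<noteq> Infinity"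
    using assms unfolding has_order_def point_multiple_def
    by (auto simp: eval_nat_numeral dest: spec[of _ 1] spec[of _ 2])
  then obtain x y where P: "P = Affine x y" by (cases P) auto
  define D where "D = 2 * y + a1 E * x + a3 E"
  define l where "l = (3 * x^2 + 2 * a2 E * x + a4 E - a1 E * y) / D"
  have D: "D \<noteq> 0" using multiples(3) by (simp add: P D_def split: if_splits)
  define x' where "x' = l^2 + a1 E * l - a2 E - x - x"
  obtain y' where "point_add E P P = Affine x' y'"
    using D by (simp add: P D_def l_def x'_def Let_def)
  \<comment> \<open>Two affine points add up to \<open>Infinity\<close> only if their
    \<open>x\<close>-coordinates agree.\<close>
  then have "x = x'"
    using multiples(1) by (simp add: P Let_def split: if_splits)
  then have "l^2 + a1 E * l = a2 E + 3 * x" by (simp add: x'_def algebra_simps)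
  moreover have "l * D = 3 * x^2 + 2 * a2 E * x + a4 E - a1 E * y" using D by (simp add: l_def)
  ultimately show ?thesis using that P D unfolding D_def by blast
qed

lemma order_three_normal_form:
  assumes E: "elliptic_curve E" and P: "P \<in> rational_points E" "has_order E P 3"
    and cubes: "\<And>d::'a::field. is_nth_power 3 d"
  shows "\<exists>a::'a. elliptic_curve (Weierstrass a 0 1 0 0) \<and> isomorphic_over E (Weierstrass a 0 1 0 0)"
proof -
  obtain x y l where xyl: "P = Affine x y" "2 * y + a1 E * x + a3 E \<noteq> 0"
    "l * (2 * y + a1 E * x + a3 E) = 3 * x^2 + 2 * a2 E * x + a4 E - a1 E * y"
    "l^2 + a1 E * l = a2 E + 3 * x"
    using order_three_point[OF P(2)] .
  obtain c where c: "2 * y + a1 E * x + a3 E = c^3"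
    using cubes by (auto simp: is_nth_power_def)
  then have c0: "c \<noteq> 0" using xyl(2) by auto
  have on_curve: "y^2 + a1 E * x * y + a3 E * y = x^3 + a2 E * x^2 + a4 E * x + a6 E"
    using P(1) xyl(1) by (auto simp: rational_points_def)
  \<comment> \<open>The four left-hand sides are \<open>a2\<close>, \<open>a3\<close>,
    \<open>a4\<close>, \<open>a6\<close> of \<open>shift_curve x l y E\<close>. The vanishing of
    \<open>a6\<close>, \<open>a4\<close>, \<open>a2\<close> says in turn that the line
    \<open>y = 0\<close> passes through the origin, is tangent there, and meets the curve there with
    multiplicity three. Scaling by \<open>1 / c\<close> then turns \<open>a3 = c^3\<close> into
    1.\<close>
  have "a2 E - l * a1 E + 3 * x - l^2 = 0" using xyl(4) by Groebner_Basis.algebra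
  moreover have "a3 E + x * a1 E + 2 * y = c^3" using c by Groebner_Basis.algebra
  moreover have "a4 E - l * a3 E + 2 * x * a2 E - (y + x * l) * a1 E + 3 * x^2 - 2 * l * y = 0"
    using xyl(3) by Groebner_Basis.algebra
  moreover have "a6 E + x * a4 E + x^2 * a2 E + x^3 - y * a3 E - y^2 - x * y * a1 E = 0"
    using on_curve by Groebner_Basis.algebra
  ultimately have "change_coordinates (1 / c) x l y E = Weierstrass ((a1 E + 2 * l) / c) 0 1 0 0"
    using c0 by (simp add: change_coordinates_def scale_curve_def shift_curve_def power_divide)
  then show ?thesis
    using elliptic_curve_change_coordinates[OF E, of "1 / c" x l y]
      isomorphic_over_change_coordinates[of "1 / c" E x l y] c0 by auto
qed

theorem lemma1:
  shows "(\<forall>a1 a3 :: 'a::{field,finite}. elliptic_curve (Weierstrass a1 0 a3 0 0) \<longrightarrow>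
      (is_nth_power 3 a3 \<longrightarrow>
         (\<exists>a. elliptic_curve (Weierstrass a 0 1 0 0) \<and>
              isomorphic_over (Weierstrass a1 0 a3 0 0) (Weierstrass a 0 1 0 0))) \<and>
      (\<forall>b0. \<not> is_nth_power 3 a3 \<and> \<not> is_nth_power 3 b0 \<longrightarrow>
         (\<exists>a. (elliptic_curve (Weierstrass a 0 b0 0 0) \<and>
               isomorphic_over (Weierstrass a1 0 a3 0 0) (Weierstrass a 0 b0 0 0)) \<or>
              (elliptic_curve (Weierstrass a 0 (b0^2) 0 0) \<and>
               isomorphic_over (Weierstrass a1 0 a3 0 0) (Weierstrass a 0 (b0^2) 0 0)))))
    \<and> ([int CARD('a) = -1] (mod 3) \<longrightarrow>
        (\<forall>E :: 'a weierstrass.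
           elliptic_curve E \<and> (\<exists>P \<in> rational_points E. has_order E P 3) \<longrightarrow>
           (\<exists>a. elliptic_curve (Weierstrass a 0 1 0 0) \<and>
                isomorphic_over E (Weierstrass a 0 1 0 0))))"
proof (intro conjI allI impI)
  fix a1 a3 :: 'a
  assume E: "elliptic_curve (Weierstrass a1 0 a3 0 0)"
  show "\<exists>a. elliptic_curve (Weierstrass a 0 1 0 0) \<and>
      isomorphic_over (Weierstrass a1 0 a3 0 0) (Weierstrass a 0 1 0 0)"
    if "is_nth_power 3 a3"
    \<comment> \<open>A cube is \<open>c^3 * 1\<close>, so the target coefficient is 1.\<close>
    using that rescale_a3[OF E, of _ 1] by (auto simp: is_nth_power_def)
  fix b0 :: 'a
  assume "\<not> is_nth_power 3 a3 \<and> \<not> is_nth_power 3 b0"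
  then obtain c where "a3 = c^3 * b0 \<or> a3 = c^3 * b0^2"
    using cube_coset_cases by blast
  then show "\<exists>a. (elliptic_curve (Weierstrass a 0 b0 0 0) \<and>
        isomorphic_over (Weierstrass a1 0 a3 0 0) (Weierstrass a 0 b0 0 0)) \<or>
      (elliptic_curve (Weierstrass a 0 (b0^2) 0 0) \<and>
        isomorphic_over (Weierstrass a1 0 a3 0 0) (Weierstrass a 0 (b0^2) 0 0))"
    using rescale_a3[OF E] by blast
next
  fix E :: "'a weierstrass"
  assume "[int CARD('a) = -1] (mod 3)"
    and "elliptic_curve E \<and> (\<exists>P \<in> rational_points E. has_order E P 3)"
  then show "\<exists>a. elliptic_curve (Weierstrass a 0 1 0 0) \<and> isomorphic_over E (Weierstrass a 0 1 0 0)"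
    using order_three_normal_form all_cubes by blast
qed

end
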